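(* Say that a shift space $X$ on a finite alphabet, with language $\mathcal{L}$, satisfies condition (H) if it has positive topological entropy and there are a nondecreasing function $g\colon\mathbb{N}\to\mathbb{N}$ with $\lim_{n\to\infty} g(n)/\log(n)=0$ and a set $\mathcal{G}\subset\mathcal{L}$ with specification such that $\mathcal{L}$ is $g$-Hamming approachable by $\mathcal{G}$. If $X$ satisfies (H), then every subshift factor of $X$ satisfies (H) as well.
   Context: $\mathbb{N}=\{1,2,3,\dots\}$. For a finite set $A$, $\sigma\colon A^{\mathbb{N}}\to A^{\mathbb{N}}$ is the left shift, and $A^{\mathbb{N}}$ has the product topology. A shift space over $A$ is a closed $\sigma$-invariant subset $X\subset A^{\mathbb{N}}$. Its language $\mathcal{L}$ is the set of all finite words (including the empty word) appearing in elements of $X$; $|w|$ is the length of $w$, and for $\mathcal{D}\subset\mathcal{L}$, $\mathcal{D}_n$ is the set of words of length $n$ in $\mathcal{D}$. A subshift factor of $X$ is a shift space $\tilde X$ on a finite alphabet for which there is a continuous surjection $\pi\colon X\to\tilde X$ with $\pi\circ\sigma=\sigma\circ\pi$. Specification: a prefix of a word $w$ is any word $w_1\cdots w_k$ with $k\le|w|$; a suffix is any word $w_k\cdots w_{|w|}$. A set $\mathcal{G}\subset\mathcal{L}$ has specification if there is $\tau\in\mathbb{N}$ such that for every $v,w\in\mathcal{G}$ there is $u\in\mathcal{L}$ with $|u|\le\tau$ such that $v'uw'\in\mathcal{G}$ whenever $v'$ is a suffix of $v$ and $w'$ is a prefix of $w$ with $v',w'\in\mathcal{G}$ (this includes the case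 $v'=v$, $w'=w$). Hamming approachability: for words $v,w$ of the same length, $d_{\mathrm{Ham}}(v,w)=\#\{i : v_i\ne w_i\}$. $\mathcal{L}$ is $g$-Hamming approachable by $\mathcal{G}$ if there is $n_0\in\mathbb{N}$ such that for every $n\ge n_0$ and $w\in\mathcal{L}_n$ there is $v\in\mathcal{G}_n$ with $d_{\mathrm{Ham}}(v,w)\le g(n)$.
   Formalization: The factor is additionally assumed to have positive topological entropy; without this the claim fails, since the one-point shift is a subshift factor of the full 2-shift, which satisfies (H), but has entropy zero. *)

theory Defs
  imports "HOL-Analysis.Analysis" "HOL-Library.Sublist"
begin

text \<open>
  Alphabets are finite subsets of an arbitrary type. One-sided sequences over the alphabet \<open>A\<close> are
  functions on \<open>nat\<close>, so coordinates are numbered from 0; the positive integers of the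
  source appear as explicit bounds \<open>\<ge> 1\<close> elsewhere.
\<close>

definition full_shift :: "'a set \<Rightarrow> (nat \<Rightarrow> 'a) topology" where
  "full_shift A = product_topology (\<lambda>_. discrete_topology A) UNIV"

definition left_shift :: "(nat \<Rightarrow> 'a) \<Rightarrow> nat \<Rightarrow> 'a" where
  "left_shift x = (\<lambda>n. x (Suc n))"

text \<open>Invariance is forward invariance: \<open>left_shift\<close> need not map \<open>X\<close> onto itself.\<close>

definition shift_space :: "'a set \<Rightarrow> (nat \<Rightarrow> 'a) set \<Rightarrow> bool" where
  "shift_space A X \<longleftrightarrow> finite A \<and> closedin (full_shift A) X \<and> left_shift ` X \<subseteq> X"

definition language :: "(nat \<Rightarrow> 'a) set \<Rightarrow> 'a list set" where
  "language X = {map x [k..<k + n] | x k n. x \<in> X}"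

definition words_of_length :: "'a list set \<Rightarrow> nat \<Rightarrow> 'a list set" where
  "words_of_length D n = {w \<in> D. length w = n}"

text \<open>
  For a nonempty shift space the limit exists, because \<open>ln\<close> of the number of words of length \<open>n\<close> is
  subadditive in \<open>n\<close>. The empty shift space gets the value 0, since \<open>ln 0 = 0\<close>.
\<close>

definition topological_entropy :: "(nat \<Rightarrow> 'a) set \<Rightarrow> real" where
  "topological_entropy X =
     lim (\<lambda>n. ln (real (card (words_of_length (language X) n))) / real n)"

definition subshift_factor ::
    "'a set \<Rightarrow> (nat \<Rightarrow> 'a) set \<Rightarrow> 'b set \<Rightarrow> (nat \<Rightarrow> 'b) set \<Rightarrow> bool" where
  "subshift_factor A X B Y \<longleftrightarrow>
     shift_space B Y \<and>
     (\<exists>\<pi>. continuous_map (subtopology (full_shift A) X) (subtopology (full_shift B) Y) \<pi> \<and>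
          \<pi> ` X = Y \<and>
          (\<forall>x\<in>X. \<pi> (left_shift x) = left_shift (\<pi> x)))"

text \<open>
  The connecting word \<open>u\<close> depends only on \<open>v\<close> and \<open>w\<close>; the same \<open>u\<close> serves all suffixes of \<open>v\<close>
  and prefixes of \<open>w\<close> that lie in \<open>G\<close>.
\<close>

definition has_specification :: "'a list set \<Rightarrow> 'a list set \<Rightarrow> bool" where
  "has_specification L G \<longleftrightarrow>
     (\<exists>\<tau>\<ge>1. \<forall>v\<in>G. \<forall>w\<in>G. \<exists>u\<in>L. length u \<le> \<tau> \<and>
        (\<forall>v' w'. suffix v' v \<and> prefix w' w \<and> v' \<in> G \<and> w' \<in> G \<longrightarrow> v' @ u @ w' \<in> G))"

definition hamming_dist :: "'a list \<Rightarrow> 'a list \<Rightarrow> nat" where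
  "hamming_dist v w = card {i. i < length w \<and> v ! i \<noteq> w ! i}"

definition hamming_approachable :: "(nat \<Rightarrow> nat) \<Rightarrow> 'a list set \<Rightarrow> 'a list set \<Rightarrow> bool" where
  "hamming_approachable g L G \<longleftrightarrow>
     (\<exists>n0\<ge>1. \<forall>n\<ge>n0. \<forall>w\<in>words_of_length L n. \<exists>v\<in>words_of_length G n. hamming_dist v w \<le> g n)"

text \<open>
  Positive entropy does not pass to factors in general (the one-point shift is a factor of every
  nonempty shift space), so a claim that a factor satisfies this condition has to presuppose it.
\<close>

definition condition_H :: "'a set \<Rightarrow> (nat \<Rightarrow> 'a) set \<Rightarrow> bool" where
  "condition_H A X \<longleftrightarrow>
     shift_space A X \<and>
     topological_entropy X > 0 \<and>
     (\<exists>(g :: nat \<Rightarrow> nat) G.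
        (\<forall>n\<ge>1. g n \<ge> 1) \<and> mono_on {1..} g \<and>
        (\<lambda>n. real (g n) / ln (real n)) \<longlonglongrightarrow> 0 \<and>
        G \<subseteq> language X \<and> has_specification (language X) G \<and>
        hamming_approachable g (language X) G)"

end

theory Submission
  imports Defs "HOL-Real_Asymp.Real_Asymp"
begin

text \<open>
  The factor map is a sliding block code, but the image of \<open>G\<close> need not have specification: a suffix of
  the image of \<open>v\<close> may lie in the image of \<open>G\<close> through a preimage unrelated to \<open>v\<close>. One repairs this
  by making the connecting word depend only on the ends of the two words. Minimising the set of
  admissible connecting words gives \<open>r\<close>, \<open>c\<close>, \<open>s\<close> such that \<open>c\<close> connects every word of \<open>G\<close> ending in \<open>r\<close> to
  every word of \<open>G\<close> starting with \<open>s\<close>. Extend \<open>r\<close> and \<open>s\<close> to one marker \<open>f\<close> starting with \<open>s\<close> and ending with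
  \<open>r\<close>, and replace \<open>G\<close> by the images of the words \<open>a @ x @ b\<close>, where \<open>x\<close> starts and ends with \<open>f\<close>, and
  \<open>a\<close> and \<open>b\<close> are a suffix and a prefix of \<open>c @ f @ c\<close> of length at most \<open>\<tau>\<close>. This padding absorbs the varying
  lengths of connecting words, so that approximating words get the exact length and alignment that the
  Hamming distance requires. If the image of \<open>f\<close> has no period at most \<open>\<tau>\<close>, which positive entropy of
  the factor allows, then the padding lengths can be read off from the ends of the image.
\<close>

section \<open>Sliding block codes on finite words\<close>

definition block_code :: "nat \<Rightarrow> ('a list \<Rightarrow> 'b) \<Rightarrow> 'a list \<Rightarrow> 'b list" where
  "block_code \<rho> \<phi> w = map (\<lambda>i. \<phi> (take (Suc \<rho>) (drop i w))) [0..<length w - \<rho>]"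

lemma length_block_code [simp]: "length (block_code \<rho> \<phi> w) = length w - \<rho>"
  by (simp add: block_code_def)

lemma nth_block_code:
  "i < length w - \<rho> \<Longrightarrow> block_code \<rho> \<phi> w ! i = \<phi> (take (Suc \<rho>) (drop i w))"
  by (simp add: block_code_def)

text \<open>A window starting in \<open>p\<close> ends inside \<open>p @ q\<close>, and every other
  window lies in \<open>q @ t\<close>. With an overlap of exactly \<rho> letters each window of
  length \<open>Suc \<rho>\<close> is thus counted once.\<close>

lemma block_code_append:
  assumes "length q = \<rho>"
  shows "block_code \<rho> \<phi> (p @ q @ t) = block_code \<rho> \<phi> (p @ q) @ block_code \<rho> \<phi> (q @ t)"
proof (rule nth_equalityI)
  fix i assume "i < length (block_code \<rho> \<phi> (p @ q @ t))"
  then have i: "i < length p + length t" using assms by simp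
  show "block_code \<rho> \<phi> (p @ q @ t) ! i = (block_code \<rho> \<phi> (p @ q) @ block_code \<rho> \<phi> (q @ t)) ! i"
  proof (cases "i < length p")
    case True
    then show ?thesis using assms by (simp add: nth_append nth_block_code)
  next
    case False
    then show ?thesis using assms i by (simp add: nth_append nth_block_code)
  qed
qed (use assms in simp)

text \<open>The middle factor depends on \<open>v\<close> and \<open>w\<close> only through the last
  \<rho> letters of \<open>v\<close> and the first \<rho> letters of \<open>w\<close>. This locality
  later makes a connecting word in the factor independent of the words it joins.\<close>

lemma block_code_join:
  assumes "\<rho> \<le> length v" "\<rho> \<le> length w"
  shows "block_code \<rho> \<phi> (v @ u @ w) =
    block_code \<rho> \<phi> v @ block_code \<rho> \<phi> (drop (length v - \<rho>) v @ u @ take \<rho> w) @ block_code \<rho> \<phi> w"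
proof -
  let ?v1 = "take (length v - \<rho>) v" and ?v2 = "drop (length v - \<rho>) v"
  let ?w1 = "take \<rho> w" and ?w2 = "drop \<rho> w"
  have "block_code \<rho> \<phi> (v @ u @ w) = block_code \<rho> \<phi> (?v1 @ ?v2 @ (u @ w))"
    by (metis append.assoc append_take_drop_id)
  also have "\<dots> = block_code \<rho> \<phi> v @ block_code \<rho> \<phi> ((?v2 @ u) @ ?w1 @ ?w2)"
    using block_code_append[of ?v2 \<rho> \<phi> ?v1 "u @ w"] assms by simp
  also have "\<dots> = block_code \<rho> \<phi> v @ block_code \<rho> \<phi> (?v2 @ u @ ?w1) @ block_code \<rho> \<phi> w"
    using block_code_append[of ?w1 \<rho> \<phi> "?v2 @ u" ?w2] assms by (simp del: append_take_drop_id) simp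
  finally show ?thesis .
qed

text \<open>The outer factors have lengths \<open>length a\<close> and \<open>length b\<close>, so
  the image of \<open>f\<close> keeps the distances that \<open>f\<close> has from the two ends of
  \<open>a @ f @ b\<close>.\<close>

lemma block_code_infix:
  assumes "\<rho> \<le> length f"
  shows "block_code \<rho> \<phi> (a @ f @ b) =
    block_code \<rho> \<phi> (a @ take \<rho> f) @ block_code \<rho> \<phi> f @ block_code \<rho> \<phi> (drop (length f - \<rho>) f @ b)"
proof -
  let ?f1 = "take (length f - \<rho>) f" and ?f2 = "drop (length f - \<rho>) f"
  have "block_code \<rho> \<phi> (a @ take \<rho> f @ (drop \<rho> f @ b)) =
      block_code \<rho> \<phi> (a @ take \<rho> f) @ block_code \<rho> \<phi> (f @ b)"
    using block_code_append[of "take \<rho> f" \<rho> \<phi> a "drop \<rho> f @ b"] assms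
    by (metis append.assoc append_take_drop_id length_take min.absorb2)
  moreover have "block_code \<rho> \<phi> (?f1 @ ?f2 @ b) = block_code \<rho> \<phi> f @ block_code \<rho> \<phi> (?f2 @ b)"
    using block_code_append[of ?f2 \<rho> \<phi> ?f1 b] assms by simp
  ultimately show ?thesis
    by (metis append.assoc append_take_drop_id)
qed

section \<open>Hamming distance, block codes and the size of Hamming balls\<close>

lemma hamming_dist_le_length: "hamming_dist v w \<le> length w"
  unfolding hamming_dist_def by (rule order_trans[OF card_mono[of "{..<length w}"]]) auto

lemma hamming_dist_append:
  assumes "length v = length w"
  shows "hamming_dist (v @ v') (w @ w') = hamming_dist v w + hamming_dist v' w'"
proof -
  let ?A = "{i. i < length w \<and> v ! i \<noteq> w ! i}" and ?B = "{i. i < length w' \<and> v' ! i \<noteq> w' ! i}"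
  have "{i. i < length (w @ w') \<and> (v @ v') ! i \<noteq> (w @ w') ! i} = ?A \<union> (+) (length w) ` ?B"
  proof (intro set_eqI iffI)
    fix i assume "i \<in> {i. i < length (w @ w') \<and> (v @ v') ! i \<noteq> (w @ w') ! i}"
    then show "i \<in> ?A \<union> (+) (length w) ` ?B"
      using assms by (cases "i < length w") (auto simp: nth_append intro!: image_eqI[of _ _ "i - length w"])
  qed (use assms in \<open>auto simp: nth_append\<close>)
  moreover have "card (?A \<union> (+) (length w) ` ?B) = card ?A + card ((+) (length w) ` ?B)"
    by (rule card_Un_disjoint) auto
  moreover have "card ((+) (length w) ` ?B) = card ?B"
    by (rule card_image) simp
  ultimately show ?thesis by (simp add: hamming_dist_def)
qed

text \<open>A changed letter at position \<open>k\<close> is seen only by the windows starting in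
  \<open>{k - \<rho>..k}\<close>, which are at most \<open>Suc \<rho>\<close> many.\<close>

lemma hamming_dist_block_code:
  assumes "length v = length w"
  shows "hamming_dist (block_code \<rho> \<phi> v) (block_code \<rho> \<phi> w) \<le> Suc \<rho> * hamming_dist v w"
proof -
  let ?D = "{i. i < length w \<and> v ! i \<noteq> w ! i}"
  have "{i. i < length (block_code \<rho> \<phi> w) \<and> block_code \<rho> \<phi> v ! i \<noteq> block_code \<rho> \<phi> w ! i}
      \<subseteq> (\<Union>k\<in>?D. {k - \<rho>..k})"
  proof
    fix i assume "i \<in> {i. i < length (block_code \<rho> \<phi> w) \<and> block_code \<rho> \<phi> v ! i \<noteq> block_code \<rho> \<phi> w ! i}"
    then have i: "i < length w - \<rho>" and "take (Suc \<rho>) (drop i v) \<noteq> take (Suc \<rho>) (drop i w)"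
      using assms by (auto simp: nth_block_code)
    then obtain m where "m < Suc \<rho>" "v ! (i + m) \<noteq> w ! (i + m)"
      using assms by (auto simp: list_eq_iff_nth_eq)
    then show "i \<in> (\<Union>k\<in>?D. {k - \<rho>..k})"
      using i by (auto intro!: exI[of _ "i + m"])
  qed
  then have "hamming_dist (block_code \<rho> \<phi> v) (block_code \<rho> \<phi> w) \<le> card (\<Union>k\<in>?D. {k - \<rho>..k})"
    unfolding hamming_dist_def by (rule card_mono[rotated]) auto
  also have "\<dots> \<le> (\<Sum>k\<in>?D. card {k - \<rho>..k})"
    by (rule card_UN_le) simp
  also have "\<dots> \<le> (\<Sum>k\<in>?D. Suc \<rho>)"
    by (rule sum_mono) auto
  finally show ?thesis by (simp add: hamming_dist_def mult.commute)
qed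

text \<open>Raising the radius by one adds words obtained by overwriting a single letter, with
  \<open>n\<close> positions and \<open>card B\<close> letters to choose from. The crude bound
  suffices for radii of logarithmic size.\<close>

lemma hamming_ball_card_bound:
  assumes "finite B" "finite P" "\<And>v. v \<in> P \<Longrightarrow> set v \<subseteq> B \<and> length v = n" "n \<ge> 1"
  shows "\<exists>N. finite N \<and> card N \<le> (n * card B) ^ h * card P \<and>
    (\<forall>y v. v \<in> P \<and> set y \<subseteq> B \<and> length y = n \<and> hamming_dist v y \<le> h \<longrightarrow> y \<in> N)"
proof (induction h)
  case 0
  have "y = v" if "v \<in> P" "length y = n" "hamming_dist v y \<le> 0" for y v
    using that assms(3)[of v] by (auto simp: hamming_dist_def list_eq_iff_nth_eq)
  then show ?case using assms(2) by (intro exI[of _ P]) auto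
next
  case (Suc h)
  then obtain N where N: "finite N" "card N \<le> (n * card B) ^ h * card P"
    and ball: "\<And>y v. v \<in> P \<Longrightarrow> set y \<subseteq> B \<Longrightarrow> length y = n \<Longrightarrow> hamming_dist v y \<le> h \<Longrightarrow> y \<in> N"
    by blast
  let ?N = "(\<lambda>(i, b, v). v[i := b]) ` ({..<n} \<times> B \<times> N)"
  have "card ?N \<le> card ({..<n} \<times> B \<times> N)"
    by (rule card_image_le) (use assms N in auto)
  also have "\<dots> = n * card B * card N" by (simp add: card_cartesian_product)
  also have "\<dots> \<le> n * card B * ((n * card B) ^ h * card P)" using N by (intro mult_left_mono) auto
  finally have "card ?N \<le> (n * card B) ^ Suc h * card P" by (simp add: mult_ac)
  moreover have "y \<in> ?N"
    if v: "v \<in> P" and y: "set y \<subseteq> B" "length y = n" and d: "hamming_dist v y \<le> Suc h" for y v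
  proof -
    have lv: "length v = n" and vB: "set v \<subseteq> B" using assms(3) v by auto
    have "\<exists>i<n. hamming_dist v (y[i := v ! i]) \<le> h"
    proof (cases "\<exists>i<n. v ! i \<noteq> y ! i")
      case True
      then obtain i where i: "i < n" "v ! i \<noteq> y ! i" by blast
      have "{k. k < length (y[i := v ! i]) \<and> v ! k \<noteq> y[i := v ! i] ! k}
          = {k. k < length y \<and> v ! k \<noteq> y ! k} - {i}"
        using i y by (auto simp: nth_list_update)
      then have "hamming_dist v (y[i := v ! i]) = hamming_dist v y - 1"
        using i y by (simp add: hamming_dist_def)
      then show ?thesis using i d by auto
    next
      \<comment> \<open>Without any disagreement, position 0 is overwritten by the letter already
        there; \<open>n \<ge> 1\<close> makes this position exist.\<close>
      case False
      then have "y = v" using y lv by (auto simp: list_eq_iff_nth_eq)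
      then have "hamming_dist v (y[0 := v ! 0]) \<le> h" by (simp add: hamming_dist_def)
      then show ?thesis using \<open>n \<ge> 1\<close> by (intro exI[of _ 0]) auto
    qed
    then obtain i where i: "i < n" "hamming_dist v (y[i := v ! i]) \<le> h" by blast
    have "v ! i \<in> B" "y ! i \<in> B" using vB y i lv by (auto simp: subset_iff)
    then have "y[i := v ! i] \<in> N"
      using i y v by (intro ball[OF v]) (auto dest: set_update_subset_insert[THEN subsetD])
    moreover have "y = (y[i := v ! i])[i := y ! i]" by simp
    ultimately show ?thesis using i \<open>y ! i \<in> B\<close>
      by (intro image_eqI[of _ _ "(i, y ! i, y[i := v ! i])"]) auto
  qed
  ultimately show ?case using assms N by (intro exI[of _ ?N]) blast
qed

section \<open>Words without short periods\<close>

definition aperiodic_upto :: "nat \<Rightarrow> 'a list \<Rightarrow> bool" where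
  "aperiodic_upto \<tau> p \<longleftrightarrow> (\<forall>e\<in>{1..\<tau>}. \<exists>k. k + e < length p \<and> p ! k \<noteq> p ! (k + e))"

lemma aperiodic_upto_infix:
  assumes "aperiodic_upto \<tau> p"
  shows "aperiodic_upto \<tau> (a @ p @ b)"
  unfolding aperiodic_upto_def
proof
  fix e assume "e \<in> {1..\<tau>}"
  then obtain k where "k + e < length p" "p ! k \<noteq> p ! (k + e)"
    using assms by (meson aperiodic_upto_def)
  then show "\<exists>k. k + e < length (a @ p @ b) \<and> (a @ p @ b) ! k \<noteq> (a @ p @ b) ! (k + e)"
    by (intro exI[of _ "length a + k"]) (auto simp: nth_append)
qed

text \<open>A shift by \<open>length p\<close> or more counts as a period, because no index can
  witness a mismatch. Excluding the period \<tau> therefore bounds the length from below.\<close>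

lemma aperiodic_upto_length_le: "aperiodic_upto \<tau> p \<Longrightarrow> \<tau> \<le> length p"
  unfolding aperiodic_upto_def by (cases "\<tau> = 0") (auto dest!: bspec[of _ _ \<tau>])

text \<open>Tails of different lengths would place two copies of \<open>p\<close> in
  \<open>v\<close>, offset by some \<open>e\<close> between 1 and \<tau>. On their overlap
  \<open>p\<close> would then have period \<open>e\<close>.\<close>

lemma aperiodic_upto_suffix_unique:
  assumes "aperiodic_upto \<tau> p" "suffix (p @ q) v" "suffix (p @ q') v"
    "length q \<le> \<tau>" "length q' \<le> \<tau>"
  shows "length q = length q'"
proof -
  have False if qs: "suffix (p @ q) v" "suffix (p @ q') v" "length q < length q'" "length q' \<le> \<tau>" for q q'
  proof -
    obtain t t' where t: "v = t @ p @ q" "v = t' @ p @ q'" using qs by (meson suffix_def)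
    define e where "e = length q' - length q"
    have "e \<in> {1..\<tau>}" using qs by (auto simp: e_def)
    then obtain k where k: "k + e < length p" "p ! k \<noteq> p ! (k + e)"
      using assms(1) by (meson aperiodic_upto_def)
    have "length t + length q = length t' + length q'"
      using arg_cong[OF t(1), of length] arg_cong[OF t(2), of length] by simp
    then have len: "length t = length t' + e" using qs by (simp add: e_def)
    have "v ! (length t + k) = p ! k" using k by (simp add: t(1) nth_append)
    moreover have "v ! (length t' + (k + e)) = p ! (k + e)" using k by (simp add: t(2) nth_append)
    ultimately show False using k len by (simp add: ac_simps)
  qed
  from this[of q q'] this[of q' q] show ?thesis using assms by (metis nat_neq_iff)
qed

lemma aperiodic_upto_prefix_unique:
  assumes "aperiodic_upto \<tau> p" "prefix (q @ p) v" "prefix (q' @ p) v"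
    "length q \<le> \<tau>" "length q' \<le> \<tau>"
  shows "length q = length q'"
proof -
  have False if qs: "prefix (q @ p) v" "prefix (q' @ p) v" "length q < length q'" "length q' \<le> \<tau>" for q q'
  proof -
    obtain t t' where t: "v = q @ p @ t" "v = q' @ p @ t'" using qs by (metis prefixE append.assoc)
    define e where "e = length q' - length q"
    have "e \<in> {1..\<tau>}" using qs by (auto simp: e_def)
    then obtain k where k: "k + e < length p" "p ! k \<noteq> p ! (k + e)"
      using assms(1) by (meson aperiodic_upto_def)
    have len: "length q' = length q + e" using qs by (simp add: e_def)
    have "v ! (length q' + k) = p ! k" using k by (simp add: t(2) nth_append)
    moreover have "v ! (length q + (k + e)) = p ! (k + e)" using k by (simp add: t(1) nth_append)
    ultimately show False using k len by (simp add: ac_simps)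
  qed
  from this[of q q'] this[of q' q] show ?thesis using assms by (metis nat_neq_iff)
qed

text \<open>A word with a period between 1 and \<tau> is determined by its first \<tau> letters,
  which gives a bound independent of \<open>n\<close>; the factor \<tau> counts the periods.\<close>

lemma card_not_aperiodic_upto:
  assumes "finite B" "\<tau> \<le> n"
  shows "card {p. set p \<subseteq> B \<and> length p = n \<and> \<not> aperiodic_upto \<tau> p} \<le> \<tau> * card B ^ \<tau>"
proof -
  define P where "P e = {p. set p \<subseteq> B \<and> length p = n \<and> (\<forall>k. k + e < n \<longrightarrow> p ! k = p ! (k + e))}" for e
  have fin: "finite (P e)" for e
    by (rule finite_subset[OF _ finite_lists_length_eq[OF assms(1), of n]]) (auto simp: P_def)
  have inj: "inj_on (take \<tau>) (P e)" if e: "e \<in> {1..\<tau>}" for e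
  proof
    fix p q assume p: "p \<in> P e" and q: "q \<in> P e" and eq: "take \<tau> p = take \<tau> q"
    have "k < n \<Longrightarrow> p ! k = q ! k" for k
    proof (induction k rule: less_induct)
      case (less k)
      show ?case
      proof (cases "k < \<tau>")
        case True then show ?thesis using eq by (metis nth_take)
      next
        case False
        then have "p ! (k - e) = p ! k" "q ! (k - e) = q ! k"
          using p q e less.prems unfolding P_def by (auto dest!: spec[of _ "k - e"])
        then show ?thesis using less.IH[of "k - e"] less.prems e False by auto
      qed
    qed
    then show "p = q" using p q by (auto simp: P_def list_eq_iff_nth_eq)
  qed
  have card: "card (P e) \<le> card B ^ \<tau>" if e: "e \<in> {1..\<tau>}" for e
  proof -
    have "card (P e) \<le> card {xs. set xs \<subseteq> B \<and> length xs = \<tau>}"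
      using assms by (intro card_inj_on_le[OF inj[OF e]] finite_lists_length_eq)
        (auto simp: P_def dest: in_set_takeD)
    then show ?thesis using assms(1) by (simp add: card_lists_length_eq)
  qed
  have "card {p. set p \<subseteq> B \<and> length p = n \<and> \<not> aperiodic_upto \<tau> p} \<le> card (\<Union>e\<in>{1..\<tau>}. P e)"
    using fin by (intro card_mono) (auto simp: P_def aperiodic_upto_def)
  also have "\<dots> \<le> (\<Sum>e\<in>{1..\<tau>}. card (P e))" by (rule card_UN_le) simp
  also have "\<dots> \<le> (\<Sum>e\<in>{1..\<tau>}. card B ^ \<tau>)" using card by (intro sum_mono)
  finally show ?thesis by simp
qed

text \<open>Otherwise every word of \<open>Y\<close> would be close to a word with a period at most \<open>\<tau>\<close>, and there are
  only subexponentially many of those.\<close>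

lemma aperiodic_approximant_exists:
  fixes Y :: "(nat \<Rightarrow> 'b) set"
  assumes ent: "topological_entropy Y > 0"
    and B: "finite B" "\<And>y. y \<in> language Y \<Longrightarrow> set y \<subseteq> B" "\<And>y. y \<in> H \<Longrightarrow> set y \<subseteq> B"
    and approx: "\<And>n y. n \<ge> n0 \<Longrightarrow> y \<in> words_of_length (language Y) n \<Longrightarrow>
      \<exists>v\<in>words_of_length H n. hamming_dist v y \<le> h n"
    and h: "eventually (\<lambda>n. real (h n) \<le> C * ln (real (n + \<rho>))) sequentially"
    and "\<tau> \<ge> 1"
  shows "\<exists>v\<in>H. aperiodic_upto \<tau> v"
proof (rule ccontr)
  assume no: "\<not> (\<exists>v\<in>H. aperiodic_upto \<tau> v)"
  \<comment> \<open>The successor ensures \<open>b \<ge> 1\<close>, so that \<open>ln b\<close> is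
    nonnegative even for an empty alphabet.\<close>
  define b where "b = Suc (card B)"
  define E where "E n = ln (real (card (words_of_length (language Y) n)))" for n
  have bound: "card (words_of_length (language Y) n) \<le> (n * b) ^ h n * (\<tau> * b ^ \<tau>)"
    if n: "n \<ge> n0" "n \<ge> \<tau>" for n
  proof -
    define P where "P = {p. set p \<subseteq> B \<and> length p = n \<and> \<not> aperiodic_upto \<tau> p}"
    have "finite P"
      by (rule finite_subset[OF _ finite_lists_length_eq[OF B(1), of n]]) (auto simp: P_def)
    moreover have "set v \<subseteq> B \<and> length v = n" if "v \<in> P" for v using that by (simp add: P_def)
    moreover have "n \<ge> 1" using n \<open>\<tau> \<ge> 1\<close> by simp
    ultimately have "\<exists>N. finite N \<and> card N \<le> (n * card B) ^ h n * card P \<and>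
        (\<forall>y v. v \<in> P \<and> set y \<subseteq> B \<and> length y = n \<and> hamming_dist v y \<le> h n \<longrightarrow> y \<in> N)"
      by (rule hamming_ball_card_bound[OF B(1)])
    then obtain N where N: "finite N" "card N \<le> (n * card B) ^ h n * card P"
      "\<And>y v. v \<in> P \<Longrightarrow> set y \<subseteq> B \<Longrightarrow> length y = n \<Longrightarrow> hamming_dist v y \<le> h n \<Longrightarrow> y \<in> N"
      by blast
    have "words_of_length (language Y) n \<subseteq> N"
    proof
      fix y assume y: "y \<in> words_of_length (language Y) n"
      then obtain v where v: "v \<in> H" "length v = n" "hamming_dist v y \<le> h n"
        using approx[OF n(1)] by (auto simp: words_of_length_def)
      then have "v \<in> P" using no B by (auto simp: P_def)
      then show "y \<in> N" using N(3) v y B(2) by (auto simp: words_of_length_def)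
    qed
    then have "card (words_of_length (language Y) n) \<le> card N" using N by (intro card_mono)
    also have "\<dots> \<le> (n * card B) ^ h n * card P" by (rule N)
    also have "\<dots> \<le> (n * card B) ^ h n * (\<tau> * card B ^ \<tau>)"
      unfolding P_def by (intro mult_left_mono card_not_aperiodic_upto B n) auto
    also have "\<dots> \<le> (n * b) ^ h n * (\<tau> * b ^ \<tau>)"
      by (intro mult_mono power_mono) (auto simp: b_def)
    finally show ?thesis .
  qed
  have upper: "eventually (\<lambda>n. E n / n \<le> (C * ln (real (n + \<rho>)) * (ln n + ln b) + ln (\<tau> * b ^ \<tau>)) / n) sequentially"
    using h eventually_ge_at_top[of "max n0 \<tau>"]
  proof eventually_elim
    case (elim n)
    then have n: "n \<ge> n0" "n \<ge> \<tau>" "n \<ge> 1" using \<open>\<tau> \<ge> 1\<close> by auto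
    have b: "b \<ge> 1" by (simp add: b_def)
    have M: "1 \<le> (n * b) ^ h n * (\<tau> * b ^ \<tau>)" using n b \<open>\<tau> \<ge> 1\<close> by simp
    have "E n \<le> ln (real ((n * b) ^ h n * (\<tau> * b ^ \<tau>)))"
    \<comment> \<open>If there are no words of length \<open>n\<close>, the convention
      \<open>ln 0 = 0\<close> applies, and the right-hand side is nonnegative by
      \<open>M\<close>.\<close>
    proof (cases "card (words_of_length (language Y) n) = 0")
      case True then show ?thesis using M by (simp only: E_def) (metis ln_0 ln_ge_zero of_nat_0 of_nat_1 of_nat_le_iff)
    next
      case False then show ?thesis
        unfolding E_def using bound[OF n(1,2)] M n b by (intro iffD2[OF ln_le_cancel_iff]) (auto simp del: of_nat_mult of_nat_power)
    qed
    also have "\<dots> = h n * (ln n + ln b) + ln (\<tau> * b ^ \<tau>)"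
      using n b \<open>\<tau> \<ge> 1\<close> by (simp add: ln_mult ln_realpow)
    also have "\<dots> \<le> C * ln (real (n + \<rho>)) * (ln n + ln b) + ln (\<tau> * b ^ \<tau>)"
      using elim n b by (intro add_right_mono mult_right_mono) auto
    finally show ?case by (intro divide_right_mono) auto
  qed
  have lower: "eventually (\<lambda>n. 0 \<le> E n / n) sequentially"
  proof (intro always_eventually allI)
    fix n
    have "0 \<le> ln (real m)" for m :: nat by (cases m) auto
    then show "0 \<le> E n / n" by (simp add: E_def)
  qed
  \<comment> \<open>The numerator grows at most like the square of \<open>ln n\<close>, which is why
    a logarithmic bound on the Hamming radius forces entropy 0.\<close>
  have "(\<lambda>n. (C * ln (real (n + \<rho>)) * (ln n + ln b) + ln (\<tau> * b ^ \<tau>)) / real n) \<longlonglongrightarrow> 0"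
    by real_asymp
  then have "(\<lambda>n. E n / n) \<longlonglongrightarrow> 0"
    by (rule tendsto_sandwich[OF lower upper tendsto_const])
  then have "topological_entropy Y = 0"
    unfolding topological_entropy_def E_def by (rule limI)
  then show False using ent by simp
qed

section \<open>Factor maps as sliding block codes\<close>

lemma full_shift_cylinder_nbhd:
  assumes "openin (full_shift A) U" "x \<in> U"
  obtains N where "\<And>x'. x' \<in> topspace (full_shift A) \<Longrightarrow> (\<And>i. i < N \<Longrightarrow> x' i = x i) \<Longrightarrow> x' \<in> U"
proof -
  obtain V where V: "finite {i. V i \<noteq> A}" "x \<in> PiE UNIV V" "PiE UNIV V \<subseteq> U"
    using assms unfolding full_shift_def openin_product_topology_alt by fastforce
  then obtain N where N: "\<forall>i\<in>{i. V i \<noteq> A}. i < N"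
    using finite_nat_set_iff_bounded by auto
  show ?thesis
  proof (rule that[of N])
    fix x' assume x': "x' \<in> topspace (full_shift A)" "\<And>i. i < N \<Longrightarrow> x' i = x i"
    have "x' i \<in> V i" for i
    proof (cases "i < N")
      case True then show ?thesis using V(2) x'(2) by auto
    next
      case False
      then have "V i = A" using N by auto
      then show ?thesis using x'(1) by (auto simp: full_shift_def)
    qed
    then show "x' \<in> U" using V(3) by auto
  qed
qed

lemma openin_full_shift_cylinder: "openin (full_shift A) {x \<in> topspace (full_shift A). \<forall>i<N. x i = a i}"
proof (induction N)
  case (Suc N)
  have "openin (full_shift A) {x \<in> topspace (full_shift A). x N \<in> {a N} \<inter> A}"
    unfolding full_shift_def
    by (rule openin_continuous_map_preimage[OF continuous_map_product_projection]) auto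
  moreover have "{x \<in> topspace (full_shift A). \<forall>i<Suc N. x i = a i} =
      {x \<in> topspace (full_shift A). \<forall>i<N. x i = a i} \<inter> {x \<in> topspace (full_shift A). x N \<in> {a N} \<inter> A}"
    by (auto simp: full_shift_def less_Suc_eq)
  ultimately show ?case using Suc by (simp add: openin_Int)
qed simp

lemma shift_space_compactin:
  assumes "shift_space A X"
  shows "compactin (full_shift A) X"
proof (rule closedin_compact_space)
  show "compact_space (full_shift A)"
    using assms unfolding full_shift_def shift_space_def
    by (simp add: compact_space_product_topology compact_space_discrete_topology)
qed (use assms in \<open>simp add: shift_space_def\<close>)

lemma shift_space_range:
  assumes "shift_space A X" "x \<in> X"
  shows "x i \<in> A"
proof -
  have "X \<subseteq> topspace (full_shift A)"
    using assms(1) by (simp add: shift_space_def closedin_subset)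
  then show ?thesis using assms(2) by (auto simp: full_shift_def)
qed

lemma left_shift_iterate: "(left_shift ^^ k) x i = x (k + i)"
proof (induction k arbitrary: i)
  case (Suc k)
  have "(left_shift ^^ Suc k) x i = (left_shift ^^ k) x (Suc i)" by (simp add: left_shift_def)
  then show ?case using Suc.IH by simp
qed simp

text \<open>This is the compactness argument of Curtis, Hedlund and Lyndon: continuity into a
  discrete space gives each point a cylinder on which the first letter of the image is constant, and
  finitely many such cylinders cover \<open>X\<close>.\<close>

lemma factor_map_local:
  assumes X: "shift_space A X"
    and cont: "continuous_map (subtopology (full_shift A) X) (subtopology (full_shift B) Y) \<pi>"
  obtains N where "\<And>x x'. x \<in> X \<Longrightarrow> x' \<in> X \<Longrightarrow> (\<And>i. i < N \<Longrightarrow> x i = x' i) \<Longrightarrow> \<pi> x 0 = \<pi> x' 0"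
proof -
  let ?T = "full_shift A"
  have XT: "X \<subseteq> topspace ?T"
    using X closedin_subset by (auto simp: shift_space_def)
  have "continuous_map (subtopology ?T X) (full_shift B) \<pi>"
    using cont continuous_map_in_subtopology by blast
  then have proj: "continuous_map (subtopology ?T X) (discrete_topology B) (\<lambda>x. \<pi> x 0)"
    unfolding full_shift_def continuous_map_componentwise_UNIV by blast
  have "\<exists>N. \<forall>x'\<in>X. (\<forall>i<N. x' i = x i) \<longrightarrow> \<pi> x' 0 = \<pi> x 0" if x: "x \<in> X" for x
  proof -
    have "openin (subtopology ?T X) {y \<in> topspace (subtopology ?T X). \<pi> y 0 \<in> {\<pi> x 0} \<inter> B}"
      by (rule openin_continuous_map_preimage[OF proj]) auto
    then obtain U where U: "openin ?T U"
      "{y \<in> topspace (subtopology ?T X). \<pi> y 0 \<in> {\<pi> x 0} \<inter> B} = U \<inter> X"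
      by (auto simp: openin_subtopology)
    have "\<pi> x 0 \<in> B"
      using continuous_map_image_subset_topspace[OF proj] x XT by auto
    then have "x \<in> U" using U(2) x XT by auto
    then obtain N where "\<And>x'. x' \<in> topspace ?T \<Longrightarrow> (\<And>i. i < N \<Longrightarrow> x' i = x i) \<Longrightarrow> x' \<in> U"
      using full_shift_cylinder_nbhd[OF U(1)] by blast
    then show ?thesis using U(2) XT by (intro exI[of _ N]) blast
  qed
  then obtain N where N: "\<And>x x'. x \<in> X \<Longrightarrow> x' \<in> X \<Longrightarrow> (\<And>i. i < N x \<Longrightarrow> x' i = x i) \<Longrightarrow> \<pi> x' 0 = \<pi> x 0"
    by metis
  define C where "C x = {y \<in> topspace ?T. \<forall>i<N x. y i = x i}" for x
  have "\<exists>\<F>. finite \<F> \<and> \<F> \<subseteq> C ` X \<and> X \<subseteq> \<Union>\<F>"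
  proof -
    have "\<forall>U\<in>C ` X. openin ?T U" by (auto simp: C_def openin_full_shift_cylinder)
    moreover have "X \<subseteq> \<Union>(C ` X)" using XT by (auto simp: C_def)
    ultimately show ?thesis
      using shift_space_compactin[OF X] unfolding compactin_def by blast
  qed
  then obtain \<F> where \<F>: "finite \<F>" "\<F> \<subseteq> C ` X" "X \<subseteq> \<Union>\<F>" by blast
  obtain F where F: "finite F" "F \<subseteq> X" "X \<subseteq> \<Union>(C ` F)"
    using finite_subset_image[OF \<F>(1,2)] \<F>(3) by blast
  \<comment> \<open>A point that agrees up to \<open>M\<close> with a point of one of the chosen
    cylinders lies in that cylinder too.\<close>
  obtain M where M: "\<And>z. z \<in> F \<Longrightarrow> N z \<le> M"
    using F(1) by (meson finite_imageI finite_nat_set_iff_bounded_le imageI)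
  show ?thesis
  proof (rule that[of M])
    fix x x' assume x: "x \<in> X" "x' \<in> X" and eq: "\<And>i. i < M \<Longrightarrow> x i = x' i"
    obtain z where z: "z \<in> F" "x \<in> C z" using F(3) x by blast
    have "x i = z i \<and> x' i = z i" if "i < N z" for i
      using z that eq[of i] M[OF z(1)] by (auto simp: C_def)
    then show "\<pi> x 0 = \<pi> x' 0" using N[of z x] N[of z x'] z F(2) x by auto
  qed
qed

lemma factor_map_block_code:
  assumes X: "shift_space A X"
    and cont: "continuous_map (subtopology (full_shift A) X) (subtopology (full_shift B) Y) \<pi>"
    and comm: "\<And>x. x \<in> X \<Longrightarrow> \<pi> (left_shift x) = left_shift (\<pi> x)"
  obtains \<rho> \<phi> where "\<And>x k n. x \<in> X \<Longrightarrow> block_code \<rho> \<phi> (map x [k..<k + (n + \<rho>)]) = map (\<pi> x) [k..<k + n]"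
proof -
  obtain \<rho> where \<rho>: "\<And>x x'. x \<in> X \<Longrightarrow> x' \<in> X \<Longrightarrow> (\<And>i. i < \<rho> \<Longrightarrow> x i = x' i) \<Longrightarrow> \<pi> x 0 = \<pi> x' 0"
    using factor_map_local[OF X cont] by blast
  \<comment> \<open>Any point showing the given window serves, since the first \<rho> coordinates
    already decide \<open>\<pi> x 0\<close>. Windows that do not begin a point of \<open>X\<close>
    get an arbitrary value.\<close>
  define \<phi> where "\<phi> w = \<pi> (SOME x. x \<in> X \<and> map x [0..<Suc \<rho>] = w) 0" for w
  have \<phi>: "\<phi> (map x [0..<Suc \<rho>]) = \<pi> x 0" if "x \<in> X" for x
  proof -
    let ?x = "SOME x'. x' \<in> X \<and> map x' [0..<Suc \<rho>] = map x [0..<Suc \<rho>]"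
    have "?x \<in> X \<and> map ?x [0..<Suc \<rho>] = map x [0..<Suc \<rho>]"
      by (rule someI[of _ x]) (use that in simp)
    then show ?thesis unfolding \<phi>_def using \<rho>[of ?x x] that by (auto simp del: upt_Suc)
  qed
  have iter: "(left_shift ^^ k) x \<in> X \<and> \<pi> ((left_shift ^^ k) x) = (left_shift ^^ k) (\<pi> x)"
    if "x \<in> X" for x k
    using X by (induction k) (auto simp: that comm shift_space_def)
  show ?thesis
  proof (rule that[of \<rho> \<phi>])
    fix x k n assume x: "x \<in> X"
    show "block_code \<rho> \<phi> (map x [k..<k + (n + \<rho>)]) = map (\<pi> x) [k..<k + n]"
    proof (rule nth_equalityI)
      fix i assume "i < length (block_code \<rho> \<phi> (map x [k..<k + (n + \<rho>)]))"
      then have i: "i < n" by simp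
      have "take (Suc \<rho>) (drop i (map x [k..<k + (n + \<rho>)])) = map ((left_shift ^^ (k + i)) x) [0..<Suc \<rho>]"
        using i by (intro nth_equalityI) (auto simp: left_shift_iterate add.assoc simp del: upt_Suc)
      then have "block_code \<rho> \<phi> (map x [k..<k + (n + \<rho>)]) ! i = \<pi> ((left_shift ^^ (k + i)) x) 0"
        using i \<phi> iter[OF x] by (simp add: nth_block_code del: upt_Suc)
      also have "\<dots> = \<pi> x (k + i)" using iter[OF x] by (simp add: left_shift_iterate)
      finally show "block_code \<rho> \<phi> (map x [k..<k + (n + \<rho>)]) ! i = map (\<pi> x) [k..<k + n] ! i"
        using i by simp
    qed simp
  qed
qed

section \<open>Languages of factors, and synchronizing words\<close>

lemma language_infix:
  assumes "p @ q @ t \<in> language X"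
  shows "q \<in> language X"
proof -
  obtain x k n where x: "x \<in> X" "p @ q @ t = map x [k..<k + n]"
    using assms by (auto simp: language_def)
  then have len: "length p + length q + length t = n"
    by (metis add.assoc add_diff_cancel_left' length_append length_map length_upt)
  have "q = take (length q) (drop (length p) (p @ q @ t))" by simp
  also have "\<dots> = map x [k + length p..<(k + length p) + length q]"
    using len unfolding x(2) by (simp add: take_map drop_map)
  finally show ?thesis using x(1) unfolding language_def by blast
qed

text \<open>A word read from \<open>\<pi> x\<close> lifts to the word of \<open>x\<close> at the
  same position with \<rho> more letters; the infinite point always supplies them.\<close>

lemma language_block_code:
  assumes "\<And>x k n. x \<in> X \<Longrightarrow> block_code \<rho> \<phi> (map x [k..<k + (n + \<rho>)]) = map (\<pi> x) [k..<k + n]"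
  shows "language (\<pi> ` X) = block_code \<rho> \<phi> ` language X"
proof (intro equalityI subsetI)
  fix y assume "y \<in> language (\<pi> ` X)"
  then obtain x k n where "x \<in> X" "y = map (\<pi> x) [k..<k + n]" by (auto simp: language_def)
  then show "y \<in> block_code \<rho> \<phi> ` language X"
    using assms[of x k n] unfolding language_def by (metis (mono_tags, lifting) imageI mem_Collect_eq)
next
  fix y assume "y \<in> block_code \<rho> \<phi> ` language X"
  then obtain x k n where x: "x \<in> X" "y = block_code \<rho> \<phi> (map x [k..<k + n])"
    by (auto simp: language_def)
  \<comment> \<open>For \<open>n < \<rho>\<close> both sides are the empty word, by truncated
    subtraction.\<close>
  then have "y = map (\<pi> x) [k..<k + (n - \<rho>)]"
    using assms[of x k "n - \<rho>"] by (cases "\<rho> \<le> n") (auto simp: block_code_def)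
  then show "y \<in> language (\<pi> ` X)" using x(1) unfolding language_def by blast
qed

lemma language_set: "shift_space A X \<Longrightarrow> w \<in> language X \<Longrightarrow> set w \<subseteq> A"
  by (auto simp: language_def shift_space_range)

text \<open>The sets of admissible connecting words shrink as \<open>v\<close> and \<open>w\<close> are extended, so they are
  constant from some pair on.\<close>

lemma specification_synchronizing_pair:
  assumes fin: "finite {u \<in> L. length u \<le> \<tau>}" and "G \<noteq> {}"
    and spec: "\<And>v w. v \<in> G \<Longrightarrow> w \<in> G \<Longrightarrow> \<exists>u\<in>L. length u \<le> \<tau> \<and>
        (\<forall>v' w'. suffix v' v \<and> prefix w' w \<and> v' \<in> G \<and> w' \<in> G \<longrightarrow> v' @ u @ w' \<in> G)"
  obtains r c s where "r \<in> G" "s \<in> G"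
    "\<And>v w. v \<in> G \<Longrightarrow> w \<in> G \<Longrightarrow> suffix r v \<Longrightarrow> prefix s w \<Longrightarrow> v @ c @ w \<in> G"
proof -
  define C where "C v w = {u \<in> L. length u \<le> \<tau> \<and>
    (\<forall>v' w'. suffix v' v \<and> prefix w' w \<and> v' \<in> G \<and> w' \<in> G \<longrightarrow> v' @ u @ w' \<in> G)}" for v w
  have finC: "finite (C v w)" for v w
    by (rule finite_subset[OF _ fin]) (auto simp: C_def)
  obtain g where "g \<in> G" using \<open>G \<noteq> {}\<close> by blast
  then obtain r s where rs: "r \<in> G" "s \<in> G"
    and least: "\<And>v w. v \<in> G \<Longrightarrow> w \<in> G \<Longrightarrow> card (C r s) \<le> card (C v w)"
    using ex_has_least_nat[of "\<lambda>(v, w). v \<in> G \<and> w \<in> G" "(g, g)" "\<lambda>(v, w). card (C v w)"] by auto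
  obtain c where c: "c \<in> C r s" using spec[OF rs] by (auto simp: C_def)
  show ?thesis
  proof (rule that[OF rs])
    fix v w assume vw: "v \<in> G" "w \<in> G" "suffix r v" "prefix s w"
    have "C v w \<subseteq> C r s"
      unfolding C_def using vw by (auto intro: suffix_order.trans prefix_order.trans)
    \<comment> \<open>A strict inclusion would make \<open>C v w\<close> smaller than the minimum
      attained at \<open>C r s\<close>.\<close>
    then have "C v w = C r s"
      using least[OF vw(1,2)] finC[of r s] by (metis card_subset_eq card_mono le_antisym)
    then have "c \<in> C v w" using c by simp
    then show "v @ c @ w \<in> G" using vw by (auto simp: C_def)
  qed
qed

lemma hamming_approachableE:
  assumes "hamming_approachable g L G"
  obtains n0 where "n0 \<ge> 1" "\<And>n w. n \<ge> n0 \<Longrightarrow> w \<in> L \<Longrightarrow> length w = n \<Longrightarrow>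
    \<exists>v\<in>G. length v = n \<and> hamming_dist v w \<le> g n"
proof -
  obtain n0 where n0: "n0 \<ge> 1"
    "\<And>n w. n \<ge> n0 \<Longrightarrow> w \<in> words_of_length L n \<Longrightarrow> \<exists>v\<in>words_of_length G n. hamming_dist v w \<le> g n"
    using assms unfolding hamming_approachable_def by blast
  show ?thesis
  proof (rule that[OF n0(1)])
    fix n w assume "n \<ge> n0" "w \<in> L" "length w = n"
    then show "\<exists>v\<in>G. length v = n \<and> hamming_dist v w \<le> g n"
      using n0(2)[of n w] by (auto simp: words_of_length_def)
  qed
qed

section \<open>Framed words around a synchronizing marker and their images\<close>

locale synchronizing_marker =
  fixes L G :: "'a list set" and f c :: "'a list" and \<rho> \<tau> :: nat and \<phi> :: "'a list \<Rightarrow> 'b"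
  assumes L_infix: "p @ q @ t \<in> L \<Longrightarrow> q \<in> L"
    and G_subset: "G \<subseteq> L"
    and f_mem: "f \<in> G"
    and sync: "v \<in> G \<Longrightarrow> w \<in> G \<Longrightarrow> suffix f v \<Longrightarrow> prefix f w \<Longrightarrow> v @ c @ w \<in> G"
    and \<rho>_le: "\<rho> \<le> length f"
    and aperiodic: "aperiodic_upto \<tau> (block_code \<rho> \<phi> f)"
begin

text \<open>The middle \<open>f\<close> makes the word at least \<tau> long, which \<open>c\<close>
  alone need not be, and lets each \<open>c\<close> stand between two occurrences of
  \<open>f\<close> when \<open>gap\<close> joins anchored words.\<close>

definition gap :: "'a list" where
  "gap = c @ f @ c"

text \<open>The left padding is a suffix and the right padding a prefix of \<open>gap\<close>, so
  what was cut off can be restored: a framed anchored word lies inside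
  \<open>f @ gap @ x @ gap @ f\<close>.\<close>

definition framed :: "nat \<Rightarrow> nat \<Rightarrow> 'a list \<Rightarrow> 'a list" where
  "framed i j x = drop (length gap - i) gap @ x @ take j gap"

definition anchored :: "'a list set" where
  "anchored = {x \<in> G. prefix f x \<and> suffix f x}"

definition framed_images :: "'b list set" where
  "framed_images = {block_code \<rho> \<phi> (framed i j x) | i j x. i \<le> \<tau> \<and> j \<le> \<tau> \<and> x \<in> anchored}"

lemma \<tau>_le_gap: "\<tau> \<le> length gap"
  using aperiodic_upto_length_le[OF aperiodic] by (simp add: gap_def)

lemma f_anchored: "f \<in> anchored"
  by (simp add: anchored_def f_mem)

lemma anchored_join: "x \<in> anchored \<Longrightarrow> y \<in> anchored \<Longrightarrow> x @ c @ y \<in> anchored"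
  by (simp add: anchored_def sync suffix_appendI)

lemma anchored_join_gap: "x \<in> anchored \<Longrightarrow> y \<in> anchored \<Longrightarrow> x @ gap @ y \<in> anchored"
  using anchored_join[of x "f @ c @ y"] anchored_join[OF f_anchored, of y] by (simp add: gap_def)

lemma framed_mem: "x \<in> anchored \<Longrightarrow> framed i j x \<in> L"
proof -
  assume x: "x \<in> anchored"
  let ?k = "length gap - i"
  have "f @ gap @ x @ gap @ f \<in> anchored"
    by (intro anchored_join_gap f_anchored x)
  then have "f @ (take ?k gap @ drop ?k gap) @ x @ (take j gap @ drop j gap) @ f \<in> L"
    using G_subset by (auto simp: anchored_def)
  then have "(f @ take ?k gap) @ framed i j x @ (drop j gap @ f) \<in> L"
    by (simp add: framed_def del: append_take_drop_id)
  then show ?thesis by (rule L_infix)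
qed

text \<open>The padding length \<open>i\<close> turns into the offset of the image of
  \<open>f\<close> from the left end. Aperiodicity recovers it from there.\<close>

lemma framed_prefix:
  assumes "x \<in> anchored" "i \<le> \<tau>"
  obtains \<alpha> where "length \<alpha> = i" "prefix (\<alpha> @ block_code \<rho> \<phi> f) (block_code \<rho> \<phi> (framed i j x))"
proof -
  obtain t where t: "x = f @ t" using assms by (auto simp: anchored_def prefix_def)
  let ?a = "drop (length gap - i) gap"
  show ?thesis
  proof
    show "length (block_code \<rho> \<phi> (?a @ take \<rho> f)) = i"
      using assms \<tau>_le_gap \<rho>_le by simp
    show "prefix (block_code \<rho> \<phi> (?a @ take \<rho> f) @ block_code \<rho> \<phi> f) (block_code \<rho> \<phi> (framed i j x))"
      using block_code_infix[OF \<rho>_le, of \<phi> ?a "t @ take j gap"] by (simp add: framed_def t)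
  qed
qed

lemma framed_suffix:
  assumes "x \<in> anchored" "j \<le> \<tau>"
  obtains \<beta> where "length \<beta> = j" "suffix (block_code \<rho> \<phi> f @ \<beta>) (block_code \<rho> \<phi> (framed i j x))"
proof -
  obtain t where t: "x = t @ f" using assms by (auto simp: anchored_def suffix_def)
  let ?b = "drop (length f - \<rho>) f @ take j gap"
  show ?thesis
  proof
    show "length (block_code \<rho> \<phi> ?b) = j"
      using assms \<tau>_le_gap \<rho>_le by simp
    show "suffix (block_code \<rho> \<phi> f @ block_code \<rho> \<phi> ?b) (block_code \<rho> \<phi> (framed i j x))"
      using block_code_infix[OF \<rho>_le, of \<phi> "drop (length gap - i) gap @ t" "take j gap"]
      by (simp add: framed_def t suffix_appendI)
  qed
qed

text \<open>It completes a right padding of length \<open>j\<close> and a left padding of length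
  \<open>k\<close> to two full gaps. They are separated by \<open>f\<close> because \<open>c\<close>
  connects only words of \<open>G\<close> that end and start with \<open>f\<close>.\<close>

definition bridge :: "nat \<Rightarrow> nat \<Rightarrow> 'a list" where
  "bridge j k = drop j gap @ f @ take (length gap - k) gap"

text \<open>The outer pieces are the letters seen by windows crossing the two junctions. Since
  \<open>\<rho> \<le> length f\<close>, they are found within the marker and its padding, so only
  \<open>j\<close> and \<open>k\<close> matter.\<close>

definition connector :: "nat \<Rightarrow> nat \<Rightarrow> 'b list" where
  "connector j k = block_code \<rho> \<phi> (drop (length (f @ take j gap) - \<rho>) (f @ take j gap) @ bridge j k @
     take \<rho> (drop (length gap - k) gap @ f))"

text \<open>The connector restores the two inner paddings to full gaps, while the outer paddings
  \<open>i\<close> and \<open>l\<close> survive. The joined word is thus again the image of a framed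
  word.\<close>

lemma framed_join:
  assumes "x \<in> anchored" "y \<in> anchored"
  shows "block_code \<rho> \<phi> (framed i j x) @ connector j k @ block_code \<rho> \<phi> (framed k l y) =
    block_code \<rho> \<phi> (framed i l (x @ gap @ f @ gap @ y))"
proof -
  obtain s where s: "x = s @ f" using assms by (auto simp: anchored_def suffix_def)
  obtain t where t: "y = f @ t" using assms by (auto simp: anchored_def prefix_def)
  have "drop (length (framed i j x) - \<rho>) (framed i j x) = drop (length (f @ take j gap) - \<rho>) (f @ take j gap)"
  proof -
    have "framed i j x = (drop (length gap - i) gap @ s) @ (f @ take j gap)"
      by (simp add: framed_def s)
    moreover have "drop (length (p @ q) - \<rho>) (p @ q) = drop (length q - \<rho>) q" if "\<rho> \<le> length q" for p q :: "'a list"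
      using that by simp
    ultimately show ?thesis using \<rho>_le by simp
  qed
  moreover have "take \<rho> (framed k l y) = take \<rho> (drop (length gap - k) gap @ f)"
    using \<rho>_le by (simp add: framed_def t)
  ultimately have "block_code \<rho> \<phi> (framed i j x @ bridge j k @ framed k l y) =
      block_code \<rho> \<phi> (framed i j x) @ connector j k @ block_code \<rho> \<phi> (framed k l y)"
    using \<rho>_le by (subst block_code_join) (simp_all add: connector_def framed_def s t)
  moreover have "framed i j x @ bridge j k @ framed k l y = framed i l (x @ gap @ f @ gap @ y)"
  proof -
    have "framed i j x @ bridge j k @ framed k l y = drop (length gap - i) gap @ x @ (take j gap @ drop j gap) @ f @
        (take (length gap - k) gap @ drop (length gap - k) gap) @ y @ take l gap"
      by (simp only: framed_def bridge_def append.assoc)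
    then show ?thesis by (simp add: framed_def)
  qed
  ultimately show ?thesis by simp
qed

text \<open>Aperiodicity of the image of \<open>f\<close> makes the padding lengths of a word in \<open>framed_images\<close> readable
  from its two ends. They are therefore shared by all its suffixes (prefixes) in \<open>framed_images\<close>, and the
  connecting word depends on nothing else.\<close>

lemma framed_images_specification: "has_specification (block_code \<rho> \<phi> ` L) framed_images"
  unfolding has_specification_def
\<comment> \<open>Coding removes \<rho> of the at most \<open>2 * \<rho>\<close> letters around the
  bridge; \<open>Suc\<close> makes the constant positive.\<close>
proof (intro exI[of _ "Suc (\<rho> + 2 * length gap + length f)"] conjI ballI)
  fix v w assume "v \<in> framed_images" "w \<in> framed_images"
  then obtain i j x k l y where v: "v = block_code \<rho> \<phi> (framed i j x)" "i \<le> \<tau>" "j \<le> \<tau>" "x \<in> anchored"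
    and w: "w = block_code \<rho> \<phi> (framed k l y)" "k \<le> \<tau>" "l \<le> \<tau>" "y \<in> anchored"
    unfolding framed_images_def by blast
  show "\<exists>u\<in>block_code \<rho> \<phi> ` L. length u \<le> Suc (\<rho> + 2 * length gap + length f) \<and>
      (\<forall>v' w'. suffix v' v \<and> prefix w' w \<and> v' \<in> framed_images \<and> w' \<in> framed_images \<longrightarrow>
        v' @ u @ w' \<in> framed_images)"
  proof (intro bexI[of _ "connector j k"] conjI allI impI)
    let ?e = "drop (length (f @ take j gap) - \<rho>) (f @ take j gap)"
    let ?h = "take \<rho> (drop (length gap - k) gap @ f)"
    show "length (connector j k) \<le> Suc (\<rho> + 2 * length gap + length f)"
    proof -
      have "length ?e \<le> \<rho>" "length ?h \<le> \<rho>" "length (bridge j k) \<le> 2 * length gap + length f"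
        by (simp_all add: bridge_def)
      then show ?thesis unfolding connector_def length_block_code length_append by linarith
    qed
    \<comment> \<open>The word coded by the connector is an infix of
      \<open>f @ gap @ f @ gap @ f\<close>, hence lies in \<open>L\<close>.\<close>
    have "(take (length (f @ take j gap) - \<rho>) (f @ take j gap) @ ?e) @ bridge j k @
        (?h @ drop \<rho> (drop (length gap - k) gap @ f)) = f @ gap @ f @ gap @ f"
    proof -
      have "(f @ take j gap) @ bridge j k @ (drop (length gap - k) gap @ f) =
          f @ (take j gap @ drop j gap) @ f @ (take (length gap - k) gap @ drop (length gap - k) gap) @ f"
        by (simp only: bridge_def append.assoc)
      then show ?thesis by (simp only: append_take_drop_id)
    qed
    moreover have "f @ gap @ f @ gap @ f \<in> L"
      using anchored_join_gap[OF f_anchored anchored_join_gap[OF f_anchored f_anchored]] G_subset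
      by (auto simp: anchored_def)
    ultimately have "take (length (f @ take j gap) - \<rho>) (f @ take j gap) @ (?e @ bridge j k @ ?h) @
        drop \<rho> (drop (length gap - k) gap @ f) \<in> L"
      by (simp only: append.assoc)
    then have "?e @ bridge j k @ ?h \<in> L" by (rule L_infix)
    then show "connector j k \<in> block_code \<rho> \<phi> ` L" unfolding connector_def by (rule imageI)
    fix v' w'
    assume *: "suffix v' v \<and> prefix w' w \<and> v' \<in> framed_images \<and> w' \<in> framed_images"
    then obtain i' j' x' k' l' y' where v': "v' = block_code \<rho> \<phi> (framed i' j' x')" "i' \<le> \<tau>" "j' \<le> \<tau>" "x' \<in> anchored"
      and w': "w' = block_code \<rho> \<phi> (framed k' l' y')" "k' \<le> \<tau>" "l' \<le> \<tau>" "y' \<in> anchored"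
      unfolding framed_images_def by blast
    have "j' = j"
    proof -
      obtain \<beta> where \<beta>: "length \<beta> = j" "suffix (block_code \<rho> \<phi> f @ \<beta>) v"
        using framed_suffix[OF v(4,3)] v(1) by metis
      obtain \<beta>' where \<beta>': "length \<beta>' = j'" "suffix (block_code \<rho> \<phi> f @ \<beta>') v'"
        using framed_suffix[OF v'(4,3)] v'(1) by metis
      have "suffix (block_code \<rho> \<phi> f @ \<beta>') v" using \<beta>'(2) * suffix_order.trans by blast
      from aperiodic_upto_suffix_unique[OF aperiodic this \<beta>(2)] show ?thesis using \<beta> \<beta>' v v' by simp
    qed
    moreover have "k' = k"
    proof -
      obtain \<alpha> where \<alpha>: "length \<alpha> = k" "prefix (\<alpha> @ block_code \<rho> \<phi> f) w"
        using framed_prefix[OF w(4,2)] w(1) by metis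
      obtain \<alpha>' where \<alpha>': "length \<alpha>' = k'" "prefix (\<alpha>' @ block_code \<rho> \<phi> f) w'"
        using framed_prefix[OF w'(4,2)] w'(1) by metis
      have "prefix (\<alpha>' @ block_code \<rho> \<phi> f) w" using \<alpha>'(2) * prefix_order.trans by blast
      from aperiodic_upto_prefix_unique[OF aperiodic this \<alpha>(2)] show ?thesis using \<alpha> \<alpha>' w w' by simp
    qed
    ultimately have "v' @ connector j k @ w' = block_code \<rho> \<phi> (framed i' l' (x' @ gap @ f @ gap @ y'))"
      using framed_join[OF v'(4) w'(4), of i' j' k' l'] v'(1) w'(1) by simp
    moreover have "x' @ gap @ f @ gap @ y' \<in> anchored"
      by (intro anchored_join_gap f_anchored v' w')
    ultimately show "v' @ connector j k @ w' \<in> framed_images"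
      unfolding framed_images_def using v' w' by blast
  qed
qed simp

lemma framed_images_subset: "framed_images \<subseteq> block_code \<rho> \<phi> ` L"
proof
  fix y assume "y \<in> framed_images"
  then obtain i j x where "y = block_code \<rho> \<phi> (framed i j x)" "x \<in> anchored"
    unfolding framed_images_def by blast
  then show "y \<in> block_code \<rho> \<phi> ` L" by (auto intro: framed_mem)
qed

text \<open>Only the middle of a preimage is approximated in \<open>G\<close>; the approximant is
  then flanked by copies of \<open>f\<close> through the connecting words of \<open>conn\<close>.
  All letters of the two end blocks are counted as errors, at a bounded cost.\<close>

lemma framed_images_approachable:
  assumes conn: "\<And>v w. v \<in> G \<Longrightarrow> w \<in> G \<Longrightarrow> \<exists>u. length u \<le> \<tau> \<and> v @ u @ w \<in> G"
    and g: "mono_on {1..} g"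
    and approach: "hamming_approachable g L G"
  shows "hamming_approachable (\<lambda>n. Suc \<rho> * (g n + 2 * (length f + \<tau>))) (block_code \<rho> \<phi> ` L) framed_images"
proof -
  obtain n0 where n0: "n0 \<ge> 1" "\<And>n w. n \<ge> n0 \<Longrightarrow> w \<in> L \<Longrightarrow> length w = n \<Longrightarrow>
      \<exists>v\<in>G. length v = n \<and> hamming_dist v w \<le> g n"
    by (rule hamming_approachableE[OF approach], rule that)
  \<comment> \<open>This is the length of each end block: the marker, plus a connecting word and a
    padding of total length \<tau>.\<close>
  define K where "K = length f + \<tau>"
  show ?thesis
    unfolding hamming_approachable_def
  proof (intro exI[of _ "n0 + 2 * K"] conjI allI impI ballI)
    fix n y assume n: "n0 + 2 * K \<le> n" and "y \<in> words_of_length (block_code \<rho> \<phi> ` L) n"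
    then obtain w where w: "w \<in> L" "y = block_code \<rho> \<phi> w" and "length w - \<rho> = n"
      by (auto simp: words_of_length_def)
    \<comment> \<open>As \<open>n \<ge> 1\<close>, the subtraction in
      \<open>length w - \<rho> = n\<close> is not truncated.\<close>
    then have lw: "length w = n + \<rho>" using n n0(1) by simp
    \<comment> \<open>The threshold on \<open>n\<close> gives \<open>m \<ge> n0\<close>, and
      \<open>\<rho> \<le> K\<close> gives \<open>m \<le> n\<close>, so monotonicity bounds
      \<open>g m\<close> by \<open>g n\<close>.\<close>
    define m where "m = n + \<rho> - 2 * K"
    have m: "n0 \<le> m" "m \<le> n" "m + 2 * K = n + \<rho>" using n \<rho>_le by (auto simp: m_def K_def)
    define w1 w2 w3 where "w1 = take K w" and "w2 = take m (drop K w)" and "w3 = drop m (drop K w)"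
    have w123: "w = w1 @ w2 @ w3" by (simp add: w1_def w2_def w3_def del: drop_drop)
    have l123: "length w1 = K" "length w2 = m" "length w3 = K"
      using lw m by (auto simp: w1_def w2_def w3_def)
    have "w2 \<in> L" using w(1) w123 L_infix by metis
    then obtain v2 where v2: "v2 \<in> G" "length v2 = m" "hamming_dist v2 w2 \<le> g m"
      using n0(2) m(1) l123(2) by metis
    obtain u where u: "length u \<le> \<tau>" "f @ u @ v2 \<in> G" using conn[OF f_mem v2(1)] by blast
    obtain u' where u': "length u' \<le> \<tau>" "(f @ u @ v2) @ u' @ f \<in> G" using conn[OF u(2) f_mem] by blast
    define x where "x = f @ u @ v2 @ u' @ f"
    have x: "x \<in> anchored"
      using u'(2) unfolding anchored_def x_def by (auto simp: suffix_def)
    \<comment> \<open>The paddings make up for connecting words shorter than \<tau>, so that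
      \<open>v2\<close> is aligned exactly with \<open>w2\<close>.\<close>
    define i j where "i = \<tau> - length u" and "j = \<tau> - length u'"
    have fr: "framed i j x = (drop (length gap - i) gap @ f @ u) @ v2 @ (u' @ f @ take j gap)"
      by (simp add: framed_def x_def)
    have lens: "length (drop (length gap - i) gap @ f @ u) = K" "length (u' @ f @ take j gap) = K"
      using \<tau>_le_gap u(1) u'(1) by (auto simp: i_def j_def K_def)
    have "hamming_dist (framed i j x) w =
        hamming_dist (drop (length gap - i) gap @ f @ u) w1 + (hamming_dist v2 w2 + hamming_dist (u' @ f @ take j gap) w3)"
      unfolding fr w123 using lens l123 v2(2)
      by (simp only: hamming_dist_append)
    also have "\<dots> \<le> K + (g m + K)"
      using v2(3) l123 by (intro add_mono) (metis hamming_dist_le_length)+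
    also have "g m \<le> g n"
      using g m n0(1) by (auto simp: mono_on_def)
    finally have d: "hamming_dist (framed i j x) w \<le> g n + 2 * K" by simp
    have l: "length (framed i j x) = length w"
      using lens l123 v2(2) by (simp only: fr w123 length_append)
    have "hamming_dist (block_code \<rho> \<phi> (framed i j x)) y \<le> Suc \<rho> * hamming_dist (framed i j x) w"
      unfolding w(2) by (rule hamming_dist_block_code[OF l])
    also have "\<dots> \<le> Suc \<rho> * (g n + 2 * (length f + \<tau>))"
      using d unfolding K_def by (intro mult_left_mono) auto
    finally have "hamming_dist (block_code \<rho> \<phi> (framed i j x)) y \<le> Suc \<rho> * (g n + 2 * (length f + \<tau>))" .
    moreover have "block_code \<rho> \<phi> (framed i j x) \<in> words_of_length framed_images n"
    proof -
      have "i \<le> \<tau>" "j \<le> \<tau>" by (simp_all add: i_def j_def)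
      then have "block_code \<rho> \<phi> (framed i j x) \<in> framed_images"
        using x unfolding framed_images_def by blast
      then show ?thesis using l lw by (simp add: words_of_length_def)
    qed
    ultimately show "\<exists>v\<in>words_of_length framed_images n. hamming_dist v y \<le> Suc \<rho> * (g n + 2 * (length f + \<tau>))"
      by blast
  qed (use n0 in simp)
qed

end

section \<open>Choice of the marker and conclusion\<close>

theorem proposition1p2:
  fixes A :: "'a set" and X :: "(nat \<Rightarrow> 'a) set"
    and B :: "'b set" and Y :: "(nat \<Rightarrow> 'b) set"
  assumes "condition_H A X"
    and "subshift_factor A X B Y"
    and "topological_entropy Y > 0"
  shows "condition_H B Y"
proof -
  obtain g G where X: "shift_space A X"
    and g: "\<forall>n\<ge>1. g n \<ge> (1::nat)" "mono_on {1..} g" "(\<lambda>n. real (g n) / ln (real n)) \<longlonglongrightarrow> 0"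
    and G: "G \<subseteq> language X" "has_specification (language X) G" "hamming_approachable g (language X) G"
    using assms(1) unfolding condition_H_def by blast
  obtain \<pi> where Y: "shift_space B Y" "\<pi> ` X = Y"
    and \<pi>: "continuous_map (subtopology (full_shift A) X) (subtopology (full_shift B) Y) \<pi>"
      "\<And>x. x \<in> X \<Longrightarrow> \<pi> (left_shift x) = left_shift (\<pi> x)"
    using assms(2) unfolding subshift_factor_def by blast
  obtain \<rho> \<phi> where "\<And>x k n. x \<in> X \<Longrightarrow> block_code \<rho> \<phi> (map x [k..<k + (n + \<rho>)]) = map (\<pi> x) [k..<k + n]"
    using factor_map_block_code[OF X \<pi>] by blast
  then have LY: "language Y = block_code \<rho> \<phi> ` language X"
    using language_block_code Y(2) by metis
  obtain \<tau> where \<tau>: "\<tau> \<ge> 1" and spec: "\<And>v w. v \<in> G \<Longrightarrow> w \<in> G \<Longrightarrow> \<exists>u\<in>language X. length u \<le> \<tau> \<and>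
        (\<forall>v' w'. suffix v' v \<and> prefix w' w \<and> v' \<in> G \<and> w' \<in> G \<longrightarrow> v' @ u @ w' \<in> G)"
    using G(2) unfolding has_specification_def by blast
  have conn: "\<exists>u. length u \<le> \<tau> \<and> v @ u @ w \<in> G" if "v \<in> G" "w \<in> G" for v w
    using spec[OF that] that by blast

  have "\<exists>v\<in>block_code \<rho> \<phi> ` G. aperiodic_upto \<tau> v"
  proof -
    obtain n0 where n0: "n0 \<ge> 1" "\<And>n w. n \<ge> n0 \<Longrightarrow> w \<in> language X \<Longrightarrow> length w = n \<Longrightarrow>
        \<exists>v\<in>G. length v = n \<and> hamming_dist v w \<le> g n"
      by (rule hamming_approachableE[OF G(3)], rule that)
    show ?thesis
    proof (rule aperiodic_approximant_exists[OF assms(3) _ _ _ _ _ \<tau>])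
      show "finite B" using Y(1) by (simp add: shift_space_def)
      show "set y \<subseteq> B" if "y \<in> language Y" for y using language_set[OF Y(1) that] .
      show "set y \<subseteq> B" if "y \<in> block_code \<rho> \<phi> ` G" for y
        using language_set[OF Y(1), of y] that G(1) LY by blast
      \<comment> \<open>Approximation takes place before coding, on words longer by \<rho>; hence
        the argument \<open>n + \<rho>\<close> of \<open>g\<close>.\<close>
      show "\<exists>v\<in>words_of_length (block_code \<rho> \<phi> ` G) n. hamming_dist v y \<le> Suc \<rho> * g (n + \<rho>)"
        if n: "n \<ge> n0" and y: "y \<in> words_of_length (language Y) n" for n y
      proof -
        obtain w where w: "w \<in> language X" "y = block_code \<rho> \<phi> w" "length w - \<rho> = n"
          using y LY by (auto simp: words_of_length_def)
        then have lw: "length w = n + \<rho>" using n n0(1) by simp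
        then obtain v where v: "v \<in> G" "length v = n + \<rho>" "hamming_dist v w \<le> g (n + \<rho>)"
          using n0(2)[of "n + \<rho>" w] n w(1) by auto
        have "hamming_dist (block_code \<rho> \<phi> v) y \<le> Suc \<rho> * hamming_dist v w"
          unfolding w(2) using v lw by (intro hamming_dist_block_code) simp
        also have "\<dots> \<le> Suc \<rho> * g (n + \<rho>)" using v(3) by (intro mult_left_mono) auto
        finally show ?thesis using v by (intro bexI[of _ "block_code \<rho> \<phi> v"]) (auto simp: words_of_length_def)
      qed
      have "eventually (\<lambda>n. real (g n) / ln (real n) < 1) sequentially"
        using order_tendstoD(2)[OF g(3), of 1] by simp
      then have "eventually (\<lambda>n. real (g n) \<le> ln (real n)) sequentially"
        using eventually_ge_at_top[of 2]
      proof eventually_elim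
        case (elim n)
        then have "ln (real n) > 0" by simp
        then show ?case using elim by (simp add: divide_simps)
      qed
      then have "eventually (\<lambda>n. real (g (n + \<rho>)) \<le> ln (real (n + \<rho>))) sequentially"
        by (rule iffD2[OF eventually_sequentially_seg])
      then show "eventually (\<lambda>n. real (Suc \<rho> * g (n + \<rho>)) \<le> real (Suc \<rho>) * ln (real (n + \<rho>))) sequentially"
        unfolding of_nat_mult by eventually_elim (rule mult_left_mono, auto)
    qed
  qed
  then obtain p where p: "p \<in> G" "aperiodic_upto \<tau> (block_code \<rho> \<phi> p)" by blast

  have ne: "G \<noteq> {}" using p(1) by blast
  have fin: "finite {u \<in> language X. length u \<le> \<tau>}"
  proof (rule finite_subset)
    show "{u \<in> language X. length u \<le> \<tau>} \<subseteq> {u. set u \<subseteq> A \<and> length u \<le> \<tau>}"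
      using language_set[OF X] by blast
    show "finite {u. set u \<subseteq> A \<and> length u \<le> \<tau>}"
      using X by (simp add: finite_lists_length_le shift_space_def)
  qed
  obtain r c s where rs: "r \<in> G" "s \<in> G"
    and sync: "\<And>v w. v \<in> G \<Longrightarrow> w \<in> G \<Longrightarrow> suffix r v \<Longrightarrow> prefix s w \<Longrightarrow> v @ c @ w \<in> G"
    by (rule specification_synchronizing_pair[OF fin ne], erule (1) spec, rule that)
  obtain u where u: "s @ u @ p \<in> G" using conn[OF rs(2) p(1)] by blast
  obtain u' where u': "(s @ u @ p) @ u' @ r \<in> G" using conn[OF u rs(1)] by blast
  \<comment> \<open>Besides the ends \<open>s\<close> and \<open>r\<close> needed for
    synchronization, the marker contains \<open>p\<close>, whose image makes that of
    \<open>f\<close> aperiodic.\<close>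
  define f where "f = s @ u @ p @ u' @ r"
  \<comment> \<open>Positivity of the truncated difference yields
    \<open>\<rho> \<le> length p\<close>, so the image of \<open>p\<close> occurs inside that of
    \<open>f\<close>.\<close>
  have \<tau>p: "1 \<le> length p - \<rho>" using aperiodic_upto_length_le[OF p(2)] \<tau> by simp
  interpret synchronizing_marker "language X" G f c \<rho> \<tau> \<phi>
  proof
    show "q \<in> language X" if "p @ q @ t \<in> language X" for p q t using that by (rule language_infix)
    show "f \<in> G" using u' by (simp add: f_def)
    show "v @ c @ w \<in> G" if "v \<in> G" "w \<in> G" "suffix f v" "prefix f w" for v w
    proof (rule sync[OF that(1,2)])
      show "suffix r v" using that(3) by (auto simp: f_def suffix_def)
      show "prefix s w" using that(4) by (auto simp: f_def prefix_def)
    qed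
    show "\<rho> \<le> length f" using \<tau>p by (simp add: f_def)
    show "aperiodic_upto \<tau> (block_code \<rho> \<phi> f)"
      using aperiodic_upto_infix[OF p(2)] block_code_infix[of \<rho> p \<phi> "s @ u" "u' @ r"] \<tau>p
      by (simp add: f_def)
  qed (rule G(1))

  \<comment> \<open>Constant factors and summands are harmless, since \<open>g\<close> is of smaller
    order than the logarithm and the logarithm tends to infinity.\<close>
  let ?g = "\<lambda>n. Suc \<rho> * (g n + 2 * (length f + \<tau>))"
  have "(\<lambda>n. real (Suc \<rho>) * (real (g n) / ln (real n) + real (2 * (length f + \<tau>)) / ln (real n)))
      \<longlonglongrightarrow> real (Suc \<rho>) * (0 + 0)"
    by (intro tendsto_intros g(3)) real_asymp
  then have "(\<lambda>n. real (?g n) / ln (real n)) \<longlonglongrightarrow> 0"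
    by (simp only: of_nat_mult of_nat_add add_divide_distrib times_divide_eq_right distrib_left) simp
  moreover have "\<forall>n\<ge>1. 1 \<le> ?g n" using g(1) by (simp add: trans_le_add1)
  moreover have "mono_on {1..} ?g"
    using g(2) by (auto simp: mono_on_def intro!: mult_le_mono add_mono)
  moreover have "hamming_approachable ?g (language Y) framed_images"
    unfolding LY using conn g(2) G(3) by (rule framed_images_approachable)
  ultimately show ?thesis
    unfolding condition_H_def
    using Y(1) assms(3) framed_images_subset[folded LY] framed_images_specification[folded LY]
    by (intro conjI exI[of _ ?g] exI[of _ framed_images])
qed

end
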